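(* Let $G=(V,E,L)$ be a graph with loops. Let $P\subseteq V$ be a (possibly empty) set of nodes with plus loops and let $M\subseteq V$ be a (possibly empty) set of nodes with $M\cap P=\emptyset$ such that, if $M\neq\emptyset$, each node in $M$ is adjacent to at least one node in $P$. For every $R\subseteq P$ define $M_R:=(M\cup P)\setminus R$. Then the following system of linear matrix inequalities defines a convex relaxation of $\mathrm{QP}(G)$: $$ \begin{bmatrix} \ell(J, M_R\setminus J) & \ell(J\cup\{i_1\}, M_R\setminus J) & \ell(J\cup\{i_2\}, M_R\setminus J) & \cdots & \ell(J\cup\{i_p\}, M_R\setminus J)\\ \ell(J\cup\{i_1\}, M_R\setminus J) & \rho(i_1,J,M_R\setminus J) & \ell(J\cup\{i_1,i_2\}, M_R\setminus J) & \cdots & \ell(J\cup\{i_1,i_p\}, M_R\setminus J)\\ \ell(J\cup\{i_2\}, M_R\setminus J) & \ell(J\cup\{i_1,i_2\}, M_R\setminus J) & \rho(i_2,J,M_R\setminus J) & \cdots & \ell(J\cup\{i_2,i_p\}, M_R\setminus J)\\ \vdots&\vdots&\vdots&\ddots&\vdots\\ \ell(J\cup\{i_p\}, M_R\setminus J) & \ell(J\cup\{i_1,i_p\}, M_R\setminus J) & \ell(J\cup\{i_2,i_p\}, M_R\setminus J) & \cdots & \rho(i_p,J,M_R\setminus J) \end{bmatrix}\succeq 0 $$ for all $R=\{i_1,\dots,i_p\}\subseteq P$ and all $J\subseteq M_R$.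
   Context: A graph with loops $G=(V,E,L)$ has a finite node set $V$, an edge set $E$ of unordered pairs $\{i,j\}$ of distinct nodes, and a set $L$ of loops $\{i,i\}$, $i\in V$, partitioned as $L=L^+\cup L^-$ into plus loops ($L^+$) and minus loops ($L^-$). Define $$\mathrm{QP}(G):=\mathrm{conv}\{z\in\mathbb{R}^{V\cup E\cup L}: z_{ii}\ge z_i^2\ \forall\{i,i\}\in L^+,\ z_{ii}\le z_i^2\ \forall\{i,i\}\in L^-,\ z_{ij}=z_iz_j\ \forall\{i,j\}\in E,\ z_i\in[0,1]\ \forall i\in V\}.$$ Variables: for each nonempty $S\subseteq M\cup P$ there is a variable $z_S$, with $z_{\{i\}}=z_i$ and, if $\{i,j\}\in E$, $z_{\{i,j\}}=z_{ij}$ (so these coincide with the coordinates of $\mathrm{QP}(G)$; the remaining $z_S$ are additional variables); set $z_\emptyset:=1$. For each $i\in P$ and each $J\subseteq (M\cup P)\setminus\{i\}$ there is a variable $z_{ii}^J$, with $z_{ii}^\emptyset:=z_{ii}$; those with $J\ne\emptyset$ are additional variables. For disjoint $J_1,J_2$ and $i\notin J_1\cup J_2$, $$\ell(J_1,J_2):=\sum_{t\subseteq J_2}(-1)^{|t|}z_{J_1\cup t},\qquad \rho(i,J_1,J_2):=\sum_{t\subseteq J_2}(-1)^{|t|}z_{ii}^{J_1\cup t}.$$ In particular $\ell(\emptyset,\emptyset)=1$. For $R=\emptyset$ the matrix is the $1\times1$ matrix $\ell(J,(M\cup P)\setminus J)$. A convex set $\mathcal{C}\subseteq\mathbb{R}^{n+d}$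 ($d\ge0$) is a convex relaxation of a convex set $\mathcal{S}\subseteq\mathbb{R}^n$ if the projection $\{x\in\mathbb{R}^n:\exists y\in\mathbb{R}^d,\ (x,y)\in\mathcal{C}\}$ contains $\mathcal{S}$. Coordinates of $\mathcal{S}$ that do not appear in the description of $\mathcal{C}$ are unrestricted (may take any real value). *)

theory Defs
  imports
    "HOL-Analysis.Finite_Function_Topology"
    "HOL-Analysis.Convex"
    "Jordan_Normal_Form.Matrix"
begin

text \<open>
  For a finite set \<open>A\<close> of coordinates, the space \<open>\<real>\<^sup>A\<close> is represented by the finitely supported
  functions vanishing outside \<open>A\<close>. Vectors over disjoint coordinate sets are concatenated by
  addition.
\<close>

definition coord_space :: "'c set \<Rightarrow> ('c \<Rightarrow>\<^sub>0 real) set" where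
  "coord_space A = {z. Poly_Mapping.keys z \<subseteq> A}"

definition convex_relaxation ::
    "'c set \<Rightarrow> 'c set \<Rightarrow> ('c \<Rightarrow>\<^sub>0 real) set \<Rightarrow> ('c \<Rightarrow>\<^sub>0 real) set \<Rightarrow> bool" where
  "convex_relaxation A B S C \<longleftrightarrow>
     finite A \<and> finite B \<and> A \<inter> B = {} \<and>
     S \<subseteq> coord_space A \<and> convex S \<and>
     C \<subseteq> coord_space (A \<union> B) \<and> convex C \<and>
     S \<subseteq> {x \<in> coord_space A. \<exists>y \<in> coord_space B. x + y \<in> C}"

text \<open>
  Edges are two-element sets of nodes; the loop at \<open>i\<close> is identified with the node \<open>i\<close>.
\<close>

record 'v loop_graph =
  nodes :: "'v set"
  edges :: "'v set set"
  plus_loops :: "'v set"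
  minus_loops :: "'v set"

definition graph_with_loops :: "'v loop_graph \<Rightarrow> bool" where
  "graph_with_loops G \<longleftrightarrow>
     finite (nodes G) \<and>
     edges G \<subseteq> {{i, j} | i j. i \<in> nodes G \<and> j \<in> nodes G \<and> i \<noteq> j} \<and>
     plus_loops G \<subseteq> nodes G \<and> minus_loops G \<subseteq> nodes G \<and>
     plus_loops G \<inter> minus_loops G = {}"

text \<open>
  \<open>Z S\<close> names the variable \<open>z\<^sub>S\<close> and \<open>ZLoop i J\<close> the variable \<open>z\<^sub>i\<^sub>i\<^sup>J\<close>. The coordinates of \<open>QP(G)\<close>
  are \<open>z\<^sub>i = Z {i}\<close>, \<open>z\<^sub>i\<^sub>j = Z {i, j}\<close> for edges, and \<open>z\<^sub>i\<^sub>i = ZLoop i {}\<close> for loops, so they are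
  shared with the relaxation whenever the same variable occurs there.
\<close>

datatype 'v coord = Z "'v set" | ZLoop 'v "'v set"

definition qp_coords :: "'v loop_graph \<Rightarrow> 'v coord set" where
  "qp_coords G =
     {Z {i} | i. i \<in> nodes G} \<union> {Z e | e. e \<in> edges G} \<union>
     {ZLoop i {} | i. i \<in> plus_loops G \<union> minus_loops G}"

definition QP :: "'v loop_graph \<Rightarrow> ('v coord \<Rightarrow>\<^sub>0 real) set" where
  "QP G = convex hull {z \<in> coord_space (qp_coords G).
     (\<forall>i \<in> plus_loops G. Poly_Mapping.lookup z (ZLoop i {}) \<ge> (Poly_Mapping.lookup z (Z {i}))\<^sup>2) \<and>
     (\<forall>i \<in> minus_loops G. Poly_Mapping.lookup z (ZLoop i {}) \<le> (Poly_Mapping.lookup z (Z {i}))\<^sup>2) \<and>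
     (\<forall>i j. {i, j} \<in> edges G \<longrightarrow>
        Poly_Mapping.lookup z (Z {i, j}) =
        Poly_Mapping.lookup z (Z {i}) * Poly_Mapping.lookup z (Z {j})) \<and>
     (\<forall>i \<in> nodes G. Poly_Mapping.lookup z (Z {i}) \<in> {0..1})}"

definition relax_coords :: "'v set \<Rightarrow> 'v set \<Rightarrow> 'v coord set" where
  "relax_coords M P =
     {Z S | S. S \<subseteq> M \<union> P \<and> S \<noteq> {}} \<union>
     {ZLoop i J | i J. i \<in> P \<and> J \<subseteq> (M \<union> P) - {i}}"

definition extra_coords :: "'v loop_graph \<Rightarrow> 'v set \<Rightarrow> 'v set \<Rightarrow> 'v coord set" where
  "extra_coords G M P = relax_coords M P - qp_coords G"

definition zvar :: "('v coord \<Rightarrow>\<^sub>0 real) \<Rightarrow> 'v set \<Rightarrow> real" where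
  "zvar z S = (if S = {} then 1 else Poly_Mapping.lookup z (Z S))"

definition ell :: "('v coord \<Rightarrow>\<^sub>0 real) \<Rightarrow> 'v set \<Rightarrow> 'v set \<Rightarrow> real" where
  "ell z J1 J2 = (\<Sum>t \<in> Pow J2. (-1) ^ card t * zvar z (J1 \<union> t))"

definition rho :: "('v coord \<Rightarrow>\<^sub>0 real) \<Rightarrow> 'v \<Rightarrow> 'v set \<Rightarrow> 'v set \<Rightarrow> real" where
  "rho z i J1 J2 = (\<Sum>t \<in> Pow J2. (-1) ^ card t * Poly_Mapping.lookup z (ZLoop i (J1 \<union> t)))"

text \<open>
  The matrix for \<open>R = set rs\<close>, where the list \<open>rs = [i\<^sub>1, \<dots>, i\<^sub>p]\<close> fixes the order of rows and
  columns. Index \<open>0\<close> is the border row or column and index \<open>a > 0\<close> belongs to \<open>i\<^sub>a = rs ! (a - 1)\<close>.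
\<close>

definition lmi_matrix ::
    "('v coord \<Rightarrow>\<^sub>0 real) \<Rightarrow> 'v set \<Rightarrow> 'v set \<Rightarrow> 'v list \<Rightarrow> 'v set \<Rightarrow> real mat" where
  "lmi_matrix z M P rs J =
     (let p = length rs; K = ((M \<union> P) - set rs) - J in
      mat (p + 1) (p + 1) (\<lambda>(a, b).
        if a = 0 \<and> b = 0 then ell z J K
        else if a = 0 then ell z (J \<union> {rs ! (b - 1)}) K
        else if b = 0 then ell z (J \<union> {rs ! (a - 1)}) K
        else if a = b then rho z (rs ! (a - 1)) J K
        else ell z (J \<union> {rs ! (a - 1), rs ! (b - 1)}) K))"

definition positive_semidefinite :: "real mat \<Rightarrow> bool" where
  "positive_semidefinite A \<longleftrightarrow>
     square_mat A \<and> transpose_mat A = A \<and>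
     (\<forall>x \<in> carrier_vec (dim_row A). x \<bullet> (A *\<^sub>v x) \<ge> 0)"

definition lmi_relaxation ::
    "'v loop_graph \<Rightarrow> 'v set \<Rightarrow> 'v set \<Rightarrow> ('v coord \<Rightarrow>\<^sub>0 real) set" where
  "lmi_relaxation G M P =
     {z \<in> coord_space (qp_coords G \<union> extra_coords G M P).
        \<forall>rs J. distinct rs \<and> set rs \<subseteq> P \<and> J \<subseteq> (M \<union> P) - set rs \<longrightarrow>
          positive_semidefinite (lmi_matrix z M P rs J)}"

end

theory Submission
  imports Defs
begin

text \<open>
  Lift a generator \<open>x\<close> of \<open>QP(G)\<close> by \<open>z\<^sub>S = \<Prod>\<^sub>i\<^sub>\<in>\<^sub>S x\<^sub>i\<close> and \<open>z\<^sub>i\<^sub>i\<^sup>J = x\<^sub>i\<^sub>i \<Prod>\<^sub>j\<^sub>\<in>\<^sub>J x\<^sub>j\<close>. Every entry of the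
  matrix for \<open>R\<close> and \<open>J\<close> then has the factor \<open>c = \<Prod>\<^sub>j\<^sub>\<in>\<^sub>J x\<^sub>j \<Prod>\<^sub>j\<^sub>\<in>\<^sub>K (1 - x\<^sub>j) \<ge> 0\<close>, where
  \<open>K = M\<^sub>R - J\<close>, and what remains is the rank-one matrix of the vector \<open>(1, x\<^sub>i)\<^sub>i\<^sub>\<in>\<^sub>R\<close> plus the
  nonnegative diagonal matrix with entries \<open>x\<^sub>i\<^sub>i - x\<^sub>i\<^sup>2\<close>. The hull of the generators is covered as
  well, because the entries of the matrices are affine in \<open>z\<close>, so that the relaxation and its
  projection are convex.
\<close>

section \<open>Vector operations on coordinate spaces\<close>

lemma lookup_scaleR:
  fixes x :: "'a \<Rightarrow>\<^sub>0 'b::real_vector"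
  shows "Poly_Mapping.lookup (r *\<^sub>R x) k = r *\<^sub>R Poly_Mapping.lookup x k"
proof -
  have "{k. r *\<^sub>R Poly_Mapping.lookup x k \<noteq> 0} \<subseteq> {k. Poly_Mapping.lookup x k \<noteq> 0}"
    by auto
  then have "finite {k. r *\<^sub>R Poly_Mapping.lookup x k \<noteq> 0}"
    by (rule finite_subset) simp
  then show ?thesis
    by (simp add: scaleR_poly_mapping_def)
qed

lemma coord_space_iff:
  "z \<in> coord_space A \<longleftrightarrow> (\<forall>k. k \<notin> A \<longrightarrow> Poly_Mapping.lookup z k = 0)"
  by (auto simp: coord_space_def in_keys_iff)

lemma convex_coord_space: "convex (coord_space A)"
  by (rule convexI) (auto simp: coord_space_iff lookup_add lookup_scaleR)

text \<open>Cutting \<open>f\<close> off outside the finite set \<open>A\<close> leaves a finite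
  support. This is how the additional variables receive prescribed values.\<close>

lemma exists_coord_space_lookup:
  assumes "finite A"
  obtains y where "y \<in> coord_space A" "\<And>k. k \<in> A \<Longrightarrow> Poly_Mapping.lookup y k = f k"
proof -
  have "finite {k. (if k \<in> A then f k else 0) \<noteq> 0}"
    by (rule finite_subset[OF _ assms]) auto
  then have "Poly_Mapping.lookup (Abs_poly_mapping (\<lambda>k. if k \<in> A then f k else 0)) =
      (\<lambda>k. if k \<in> A then f k else 0)"
    by simp
  then show thesis
    by (intro that[of "Abs_poly_mapping (\<lambda>k. if k \<in> A then f k else 0)"])
      (auto simp: coord_space_iff)
qed

text \<open>The weights that combine two points also combine their witnesses \<open>y\<close> and
  \<open>y'\<close>.\<close>

lemma convex_projection:
  assumes "convex C"
  shows "convex {x \<in> coord_space A. \<exists>y \<in> coord_space B. x + y \<in> C}"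
proof (rule convexI, clarsimp, intro conjI)
  fix x x' y y' and u v :: real
  assume "0 \<le> u" "0 \<le> v" "u + v = 1"
    and xs: "x \<in> coord_space A" "x' \<in> coord_space A"
    and ys: "y \<in> coord_space B" "y' \<in> coord_space B"
    and C: "x + y \<in> C" "x' + y' \<in> C"
  then show "u *\<^sub>R x + v *\<^sub>R x' \<in> coord_space A"
    by (intro convexD[OF convex_coord_space])
  have "u *\<^sub>R y + v *\<^sub>R y' \<in> coord_space B"
    using \<open>0 \<le> u\<close> \<open>0 \<le> v\<close> \<open>u + v = 1\<close> ys by (intro convexD[OF convex_coord_space])
  moreover have "u *\<^sub>R (x + y) + v *\<^sub>R (x' + y') \<in> C"
    using \<open>0 \<le> u\<close> \<open>0 \<le> v\<close> \<open>u + v = 1\<close> C by (intro convexD[OF assms])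
  ultimately show "\<exists>y \<in> coord_space B. u *\<^sub>R x + v *\<^sub>R x' + y \<in> C"
    by (intro bexI[of _ "u *\<^sub>R y + v *\<^sub>R y'"]) (auto simp: algebra_simps)
qed

section \<open>Quadratic forms and positive semidefiniteness\<close>

lemma quadratic_form_sum:
  fixes A :: "'a::comm_semiring_0 mat"
  assumes "A \<in> carrier_mat n n" "x \<in> carrier_vec n"
  shows "x \<bullet> (A *\<^sub>v x) = (\<Sum>a<n. \<Sum>b<n. x $ a * A $$ (a, b) * x $ b)"
  using assms
  by (auto simp: scalar_prod_def sum_distrib_left mult.assoc lessThan_atLeast0 intro!: sum.cong)

lemma positive_semidefinite_combination:
  assumes "A \<in> carrier_mat n n" "B \<in> carrier_mat n n"
    and psd: "positive_semidefinite A" "positive_semidefinite B"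
    and "0 \<le> u" "0 \<le> v"
  shows "positive_semidefinite (u \<cdot>\<^sub>m A + v \<cdot>\<^sub>m B)"
  unfolding positive_semidefinite_def
proof (intro conjI ballI)
  show "square_mat (u \<cdot>\<^sub>m A + v \<cdot>\<^sub>m B)"
    using assms by simp
  have sym: "A $$ (i, j) = A $$ (j, i)" "B $$ (i, j) = B $$ (j, i)" if "i < n" "j < n" for i j
    using psd assms(1,2) that
    by (metis carrier_matD index_transpose_mat(1) positive_semidefinite_def)+
  show "transpose_mat (u \<cdot>\<^sub>m A + v \<cdot>\<^sub>m B) = u \<cdot>\<^sub>m A + v \<cdot>\<^sub>m B"
    using assms(1,2) sym by (intro eq_matI) auto
  fix x :: "real vec" assume "x \<in> carrier_vec (dim_row (u \<cdot>\<^sub>m A + v \<cdot>\<^sub>m B))"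
  then have x: "x \<in> carrier_vec n"
    using assms by simp
  have "x \<bullet> ((u \<cdot>\<^sub>m A + v \<cdot>\<^sub>m B) *\<^sub>v x) =
      (\<Sum>a<n. \<Sum>b<n. x $ a * (u \<cdot>\<^sub>m A + v \<cdot>\<^sub>m B) $$ (a, b) * x $ b)"
    using assms x by (intro quadratic_form_sum) auto
  also have "\<dots> = (\<Sum>a<n. \<Sum>b<n. u * (x $ a * A $$ (a, b) * x $ b) + v * (x $ a * B $$ (a, b) * x $ b))"
    using assms(1,2) by (intro sum.cong refl) (auto simp: algebra_simps)
  also have "\<dots> = u * (x \<bullet> (A *\<^sub>v x)) + v * (x \<bullet> (B *\<^sub>v x))"
    using assms(1,2) x by (simp add: quadratic_form_sum sum.distrib sum_distrib_left)
  also have "\<dots> \<ge> 0"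
    using assms x by (auto simp: positive_semidefinite_def)
  finally show "0 \<le> x \<bullet> ((u \<cdot>\<^sub>m A + v \<cdot>\<^sub>m B) *\<^sub>v x)" .
qed

text \<open>The quadratic form is \<open>c\<close> times a sum of two nonnegative terms: the square
  of \<open>\<Sum>a<n. f a * x $ a\<close> and the weighted squares
  \<open>d a * (x $ a)\<^sup>2\<close>.\<close>

lemma positive_semidefinite_rank_one_plus_diagonal:
  fixes f d :: "nat \<Rightarrow> real"
  assumes "0 \<le> c" "\<And>a. a < n \<Longrightarrow> 0 \<le> d a"
  shows "positive_semidefinite (mat n n (\<lambda>(a, b). c * (f a * f b + (if a = b then d a else 0))))"
    (is "positive_semidefinite ?A")
  unfolding positive_semidefinite_def
proof (intro conjI ballI)
  show "square_mat ?A" "transpose_mat ?A = ?A"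
    by (auto intro!: eq_matI)
  fix x :: "real vec" assume "x \<in> carrier_vec (dim_row ?A)"
  then have x: "x \<in> carrier_vec n"
    by simp
  have "x \<bullet> (?A *\<^sub>v x) = (\<Sum>a<n. \<Sum>b<n. x $ a * ?A $$ (a, b) * x $ b)"
    using x by (intro quadratic_form_sum) auto
  also have "\<dots> = (\<Sum>a<n. \<Sum>b<n. c * ((f a * x $ a) * (f b * x $ b)) +
      (if a = b then c * (d a * (x $ a)\<^sup>2) else 0))"
    by (intro sum.cong refl) (auto simp: algebra_simps power2_eq_square)
  also have "\<dots> = (\<Sum>a<n. \<Sum>b<n. c * ((f a * x $ a) * (f b * x $ b))) + c * (\<Sum>a<n. d a * (x $ a)\<^sup>2)"
    by (simp add: sum.distrib sum_distrib_left)
  also have "\<dots> = c * ((\<Sum>a<n. f a * x $ a)\<^sup>2 + (\<Sum>a<n. d a * (x $ a)\<^sup>2))"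
    by (simp add: power2_eq_square[of "sum _ _"] sum_product sum_distrib_left[of c] distrib_left)
  also have "\<dots> \<ge> 0"
    using assms by (intro mult_nonneg_nonneg add_nonneg_nonneg sum_nonneg) auto
  finally show "0 \<le> x \<bullet> (?A *\<^sub>v x)" .
qed

section \<open>Convexity of the relaxation\<close>

lemma zvar_affine:
  assumes "u + v = 1"
  shows "zvar (u *\<^sub>R z + v *\<^sub>R w) S = u * zvar z S + v * zvar w S"
  using assms by (simp add: zvar_def lookup_add lookup_scaleR)

text \<open>The variable of the empty set is the constant 1, which a combination preserves exactly
  when \<open>u + v = 1\<close>.\<close>

lemma ell_affine:
  assumes "u + v = 1"
  shows "ell (u *\<^sub>R z + v *\<^sub>R w) J K = u * ell z J K + v * ell w J K"
  using assms by (simp add: ell_def zvar_affine algebra_simps sum.distrib sum_distrib_left)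

text \<open>Every term is a genuine coordinate, also for the empty superscript, so no constant
  restricts the weights.\<close>

lemma rho_linear:
  "rho (u *\<^sub>R z + v *\<^sub>R w) i J K = u * rho z i J K + v * rho w i J K"
  by (simp add: rho_def lookup_add lookup_scaleR algebra_simps sum.distrib sum_distrib_left)

lemma lmi_matrix_carrier: "lmi_matrix z M P rs J \<in> carrier_mat (length rs + 1) (length rs + 1)"
  by (simp add: lmi_matrix_def Let_def)

lemma lmi_matrix_affine:
  assumes "u + v = 1"
  shows "lmi_matrix (u *\<^sub>R z + v *\<^sub>R w) M P rs J =
    u \<cdot>\<^sub>m lmi_matrix z M P rs J + v \<cdot>\<^sub>m lmi_matrix w M P rs J"
  using assms
  by (intro eq_matI) (auto simp: lmi_matrix_def Let_def ell_affine rho_linear)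

lemma convex_lmi_relaxation: "convex (lmi_relaxation G M P)"
proof (rule convexI)
  fix z w and u v :: real
  assume z: "z \<in> lmi_relaxation G M P" and w: "w \<in> lmi_relaxation G M P"
    and uv: "0 \<le> u" "0 \<le> v" "u + v = 1"
  have "u *\<^sub>R z + v *\<^sub>R w \<in> coord_space (qp_coords G \<union> extra_coords G M P)"
    using z w uv by (intro convexD[OF convex_coord_space]) (auto simp: lmi_relaxation_def)
  moreover have "positive_semidefinite (lmi_matrix (u *\<^sub>R z + v *\<^sub>R w) M P rs J)"
    if "distinct rs" "set rs \<subseteq> P" "J \<subseteq> M \<union> P - set rs" for rs J
    unfolding lmi_matrix_affine[OF uv(3)]
    using z w uv that
    by (intro positive_semidefinite_combination[OF lmi_matrix_carrier lmi_matrix_carrier])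
      (auto simp: lmi_relaxation_def)
  ultimately show "u *\<^sub>R z + v *\<^sub>R w \<in> lmi_relaxation G M P"
    by (auto simp: lmi_relaxation_def)
qed

section \<open>The matrices at a product lift\<close>

lemma sum_prod_inclusion_exclusion:
  fixes x :: "'a \<Rightarrow> 'b::comm_ring_1"
  assumes "finite J" "finite K" "J \<inter> K = {}"
  shows "(\<Sum>t\<in>Pow K. (-1) ^ card t * prod x (J \<union> t)) = prod x J * (\<Prod>j\<in>K. 1 - x j)"
proof -
  \<comment> \<open>Disjointness lets \<open>prod x J\<close> be pulled out; the alternating sum
    that remains is the expansion of the product of \<open>1 - x j\<close> over
    \<open>K\<close>.\<close>
  have "prod x (J \<union> t) = prod x J * prod x t" if "t \<in> Pow K" for t
    using assms that by (intro prod.union_disjoint) (auto intro: finite_subset)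
  then show ?thesis
    by (auto simp: prod_diff_conv_sum[OF assms(2)] sum_distrib_left intro!: sum.cong)
qed

text \<open>Isolates the graph-free part of the argument: product values of the variables, the box
  for \<open>x\<close> and the plus-loop inequality for \<open>q\<close>.\<close>

lemma positive_semidefinite_lmi_matrix_product:
  assumes fin: "finite M" "finite P"
    and zvar: "\<And>S. S \<subseteq> M \<union> P \<Longrightarrow> zvar z S = prod x S"
    and zloop: "\<And>i J. i \<in> P \<Longrightarrow> J \<subseteq> M \<union> P - {i} \<Longrightarrow>
      Poly_Mapping.lookup z (ZLoop i J) = q i * prod x J"
    and x: "\<And>i. i \<in> M \<union> P \<Longrightarrow> x i \<in> {0..1}"
    and q: "\<And>i. i \<in> P \<Longrightarrow> (x i)\<^sup>2 \<le> q i"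
    and rs: "distinct rs" "set rs \<subseteq> P" and J: "J \<subseteq> M \<union> P - set rs"
  shows "positive_semidefinite (lmi_matrix z M P rs J)"
proof -
  define K where "K = M \<union> P - set rs - J"
  define c where "c = prod x J * (\<Prod>j\<in>K. 1 - x j)"
  \<comment> \<open>Index 0 is the border: there \<open>f\<close> is 1 and \<open>d\<close> is 0.
    Index \<open>a > 0\<close> belongs to the list position \<open>a - 1\<close>.\<close>
  define f where "f = (\<lambda>a. if a = 0 then 1 else x (rs ! (a - 1)))"
  define d where "d = (\<lambda>a. if a = 0 then 0 else q (rs ! (a - 1)) - (x (rs ! (a - 1)))\<^sup>2)"
  have finJK: "finite J" "finite K"
    using fin J by (auto simp: K_def intro: finite_subset)
  \<comment> \<open>Taking \<open>I\<close> empty, a singleton or a pair covers all entries except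
    the diagonal ones below the border.\<close>
  have ell: "ell z (J \<union> I) K = c * prod x I" if "I \<subseteq> set rs" for I
  proof -
    have "ell z (J \<union> I) K = (\<Sum>t\<in>Pow K. (-1) ^ card t * prod x (J \<union> I \<union> t))"
      unfolding ell_def using that rs J by (intro sum.cong refl) (subst zvar, auto simp: K_def)
    also have "\<dots> = prod x (J \<union> I) * (\<Prod>j\<in>K. 1 - x j)"
      using finJK that by (intro sum_prod_inclusion_exclusion) (auto simp: K_def intro: finite_subset)
    also have "prod x (J \<union> I) = prod x J * prod x I"
      using finJK that J by (intro prod.union_disjoint) (auto intro: finite_subset)
    finally show ?thesis
      by (simp add: c_def mult_ac)
  qed
  have rho: "rho z i J K = c * q i" if "i \<in> set rs" for i
  proof -
    have "rho z i J K = (\<Sum>t\<in>Pow K. (-1) ^ card t * (q i * prod x (J \<union> t)))"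
      unfolding rho_def using that rs J by (intro sum.cong refl) (subst zloop, auto simp: K_def)
    also have "\<dots> = q i * (\<Sum>t\<in>Pow K. (-1) ^ card t * prod x (J \<union> t))"
      by (simp add: sum_distrib_left mult_ac)
    also have "\<dots> = c * q i"
      using finJK by (subst sum_prod_inclusion_exclusion) (auto simp: K_def c_def)
    finally show ?thesis .
  qed
  have ell2: "ell z (J \<union> {rs ! (a - 1), rs ! (b - 1)}) K = c * (x (rs ! (a - 1)) * x (rs ! (b - 1)))"
    if "a \<noteq> b" "0 < a" "0 < b" "a < length rs + 1" "b < length rs + 1" for a b
  proof -
    \<comment> \<open>Positive indices stay distinct after the shift, and \<open>rs\<close> has no
      repetitions, so the pair really has two elements and its product has two factors.\<close>
    have "a - 1 < length rs" "b - 1 < length rs" "a - 1 \<noteq> b - 1"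
      using that by auto
    then show ?thesis
      using rs(1) by (subst ell) (auto simp: nth_eq_iff_index_eq)
  qed
  have "lmi_matrix z M P rs J = mat (length rs + 1) (length rs + 1)
      (\<lambda>(a, b). c * (f a * f b + (if a = b then d a else 0)))" (is "_ = ?A")
  proof (rule eq_matI)
    fix a b assume "a < dim_row ?A" "b < dim_col ?A"
    then have ab: "a < length rs + 1" "b < length rs + 1"
      by auto
    show "lmi_matrix z M P rs J $$ (a, b) = ?A $$ (a, b)"
      using ab ell[of "{}"] ell[of "{rs ! (a - 1)}"] ell[of "{rs ! (b - 1)}"]
        ell2[of a b] rho[of "rs ! (a - 1)"]
      by (auto simp: lmi_matrix_def Let_def K_def[symmetric] f_def d_def power2_eq_square)
  qed (auto simp: lmi_matrix_def Let_def)
  moreover have "0 \<le> c"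
    unfolding c_def using x J by (intro mult_nonneg_nonneg prod_nonneg ballI) (auto simp: K_def)
  moreover have "0 \<le> d a" if "a < length rs + 1" for a
    using that q[OF subsetD[OF rs(2) nth_mem], of "a - 1"] by (auto simp: d_def)
  ultimately show ?thesis
    by (simp add: positive_semidefinite_rank_one_plus_diagonal)
qed

section \<open>Finiteness of the coordinates and lifting of the generators\<close>

lemma finite_edges:
  assumes "graph_with_loops G"
  shows "finite (edges G)"
  by (rule finite_subset[of _ "Pow (nodes G)"])
    (use assms in \<open>auto simp: graph_with_loops_def\<close>)

lemma finite_qp_coords:
  assumes "graph_with_loops G"
  shows "finite (qp_coords G)"
proof -
  have "qp_coords G = (\<lambda>i. Z {i}) ` nodes G \<union> Z ` edges G \<union>
      (\<lambda>i. ZLoop i {}) ` (plus_loops G \<union> minus_loops G)"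
    by (auto simp: qp_coords_def)
  then show ?thesis
    using assms finite_edges[OF assms] by (auto simp: graph_with_loops_def intro: finite_subset)
qed

lemma finite_relax_coords:
  assumes "finite M" "finite P"
  shows "finite (relax_coords M P)"
proof -
  have "relax_coords M P \<subseteq> Z ` Pow (M \<union> P) \<union> (\<lambda>(i, J). ZLoop i J) ` (P \<times> Pow (M \<union> P))"
    by (auto simp: relax_coords_def)
  then show ?thesis
    by (rule finite_subset) (use assms in auto)
qed

theorem theorem3:
  fixes G :: "'v loop_graph" and P M :: "'v set"
  assumes "graph_with_loops G"
    and "P \<subseteq> nodes G" and "P \<subseteq> plus_loops G"
    and "M \<subseteq> nodes G" and "M \<inter> P = {}"
    and "M \<noteq> {} \<longrightarrow> (\<forall>m \<in> M. \<exists>p \<in> P. {m, p} \<in> edges G)"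
  shows "convex_relaxation (qp_coords G) (extra_coords G M P) (QP G) (lmi_relaxation G M P)"
proof -
  let ?A = "qp_coords G" and ?B = "extra_coords G M P" and ?C = "lmi_relaxation G M P"
  let ?L = "Poly_Mapping.lookup"
  have fin: "finite M" "finite P"
    using assms by (auto simp: graph_with_loops_def intro: finite_subset)
  have finB: "finite ?B"
    using finite_relax_coords[OF fin] by (simp add: extra_coords_def)
  have QP_coords: "QP G \<subseteq> coord_space ?A"
    unfolding QP_def by (rule hull_minimal) (auto simp: convex_coord_space)
  have "QP G \<subseteq> {x \<in> coord_space ?A. \<exists>y \<in> coord_space ?B. x + y \<in> ?C}"
    unfolding QP_def
  \<comment> \<open>The projection is convex, so it suffices to lift a single generator
    \<open>z\<close>.\<close>
  proof (intro hull_minimal convex_projection convex_lmi_relaxation subsetI, clarsimp)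
    fix z
    assume z: "z \<in> coord_space ?A"
      and plus: "\<forall>i\<in>plus_loops G. (?L z (Z {i}))\<^sup>2 \<le> ?L z (ZLoop i {})"
      and edge: "\<forall>i j. {i, j} \<in> edges G \<longrightarrow> ?L z (Z {i, j}) = ?L z (Z {i}) * ?L z (Z {j})"
      and node: "\<forall>i\<in>nodes G. 0 \<le> ?L z (Z {i}) \<and> ?L z (Z {i}) \<le> 1"
    define x where "x = (\<lambda>i. ?L z (Z {i}))"
    define q where "q = (\<lambda>i. ?L z (ZLoop i {}))"
    \<comment> \<open>Only variables outside \<open>?A\<close> are free to choose; \<open>z\<close>
      already fixes the others, so their agreement with the lift has to be proved.\<close>
    obtain y where y: "y \<in> coord_space ?B"
      and y_eq: "\<And>k. k \<in> ?B \<Longrightarrow>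
        ?L y k = (case k of Z S \<Rightarrow> prod x S | ZLoop i J \<Rightarrow> q i * prod x J)"
      using exists_coord_space_lookup[OF finB] by blast
    have low: "?L (z + y) k = ?L z k" if "k \<in> ?A" for k
      using y that by (simp add: lookup_add coord_space_iff extra_coords_def)
    have high: "?L (z + y) k = (case k of Z S \<Rightarrow> prod x S | ZLoop i J \<Rightarrow> q i * prod x J)"
      if "k \<in> relax_coords M P" "k \<notin> ?A" for k
      using z y_eq[of k] that by (simp add: lookup_add coord_space_iff extra_coords_def)
    have zvar: "zvar (z + y) S = prod x S" if "S \<subseteq> M \<union> P" for S
    proof -
      \<comment> \<open>A variable shared with \<open>QP G\<close> belongs to a node or an edge. For
        a node the product is \<open>x i\<close> by definition, for an edge it is the constraint of
        \<open>QP G\<close>; any other nonempty set gets its value from \<open>y\<close>.\<close>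
      consider "S = {}" | "S \<noteq> {}" "Z S \<notin> ?A" | i where "S = {i}" "Z S \<in> ?A"
        | i j where "S = {i, j}" "i \<noteq> j" "S \<in> edges G" "Z S \<in> ?A"
        using assms(1) by (auto simp: qp_coords_def graph_with_loops_def) blast
      then show ?thesis
      proof cases
        case 2
        moreover have "Z S \<in> relax_coords M P"
          using 2 that by (auto simp: relax_coords_def)
        ultimately show ?thesis
          by (simp add: zvar_def high)
      qed (use edge in \<open>auto simp: zvar_def low x_def\<close>)
    qed
    have zloop: "?L (z + y) (ZLoop i J) = q i * prod x J"
      if "i \<in> P" "J \<subseteq> M \<union> P - {i}" for i J
    \<comment> \<open>The loop variable with empty superscript is shared, since \<open>P\<close>
      consists of nodes with plus loops; those with nonempty superscript are all additional.\<close>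
    proof (cases "J = {}")
      case True
      then have "ZLoop i J \<in> ?A"
        using that assms(3) by (auto simp: qp_coords_def)
      then show ?thesis
        using True by (simp add: low q_def)
    next
      case False
      then have "ZLoop i J \<in> relax_coords M P" "ZLoop i J \<notin> ?A"
        using that by (auto simp: qp_coords_def relax_coords_def)
      then show ?thesis
        by (simp add: high)
    qed
    have "positive_semidefinite (lmi_matrix (z + y) M P rs J)"
      if "distinct rs" "set rs \<subseteq> P" "J \<subseteq> M \<union> P - set rs" for rs J
      by (rule positive_semidefinite_lmi_matrix_product[OF fin zvar zloop _ _ that])
        (use plus node assms in \<open>auto simp: x_def q_def\<close>)
    moreover have "z + y \<in> coord_space (?A \<union> ?B)"
      using z y by (simp add: coord_space_iff lookup_add)
    ultimately have "z + y \<in> ?C"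
      by (simp add: lmi_relaxation_def)
    with y show "\<exists>y\<in>coord_space ?B. z + y \<in> ?C"
      by blast
  qed
  then show ?thesis
    unfolding convex_relaxation_def
    using finite_qp_coords[OF assms(1)] finB QP_coords convex_lmi_relaxation[of G M P]
    by (auto simp: QP_def extra_coords_def lmi_relaxation_def)
qed

end
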